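(* Work in ZF+DC. Let $(K,+)$ be a commutative group. The following are equivalent: (1) There is a biased predictor, i.e. a family of functions $G_n:{}^\omega K\to K$ ($n\in\omega$) such that $G_n(f)$ does not depend on $f(n)$, and for every $f\in{}^\omega K$ there is $k\in K$ with $G_n(f)=f(n)+k$ for all $n\in\omega$. (2) There is a signal-biased predictor, i.e. some $s\in\omega$, a function $G_s:{}^\omega K\to K$ with $G_s(f)$ not depending on $f(s)$, and for each $n\in\omega\setminus\{s\}$ a function $G_n:{}^\omega K\times K\to K$ with $G_n(f,k)$ not depending on $f(n)$, such that for every $f\in{}^\omega K$: $G_n(f,G_s(f))=f(n)$ for every $n\in\omega\setminus\{s\}$, and $G_n(f,k)-G_n(f,l)=l-k$ for all $k,l\in K$ and all $n\in\omega\setminus\{s\}$. (3) There is a starter-biased predictor, i.e. a family of functions $G_n:{}^\omega K\to K$ ($n\in\omega$) with $G_n(f)$ not depending on $f(n)$, such that for every $f\in{}^\omega K$: $G_n(f[0|G_0(f)])=f(n)$ for every $n\in\omega\setminus\{0\}$, and $G_n(f[0|k])-G_n(f[0|l])=l-k$ for all $k,l\in K$ and all $n\in\omega\setminus\{0\}$. (4) There is a $K$-parity function, i.e. a function $p:{}^\omega K\to K$ such that for all $f\in{}^\omega K$, $n\in\omega$ and $k,l\in K$, $p(f[n|k])-p(f[n|l])=l-k$.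
   Context: For a function $\varphi$ with domain $D$, $d\in D$ and a value $v$, $\varphi[d|v]$ denotes $(\varphi\restriction(D\setminus\{d\}))\cup\{\langle d,v\rangle\}$. Elements $f\in{}^\omega K$ are colorings of the agents $\omega$ by hat colors from $K$. "$G(f)$ does not depend on $f(a)$" means $G(f)=G(g)$ (resp. $G(f,k)=G(g,k)$) whenever $f,g\in{}^\omega K$ agree off $a$. Interpretation: (1) is a puzzle with complete visibility and simultaneous declaration; (2) is a puzzle with complete visibility where signaler $s$ declares first and the others then declare simultaneously knowing the signal (second argument); (3) is a puzzle where agent $a$ sees exactly the agents $x>a$ and agents declare one by one in the order of $\omega$, the value of the argument at agents before $a$ being their declarations. *)

theory Defs
  imports "HOL-Algebra.Group"
begin

text \<open>
  The ambient theory ZF+DC is not HOL: HOL has a choice operator, so over the HOL function space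
  \<open>nat \<Rightarrow> 'k\<close> all four kinds of predictors would exist outright. Therefore ZF+DC is represented by
  its models. A type of class \<open>zf_dc\<close> is the universe of an arbitrary (not necessarily standard or
  transitive) model of ZF+DC, and groups, colorings and predictors are elements of that universe.
  By Goedel completeness, a first-order sentence holds in all these models iff ZF+DC proves it.
\<close>

section \<open>First-order formulas of set theory\<close>

text \<open>
  The Separation and Replacement schemas range over first-order formulas only, so formulas are
  syntactic objects. Variables are de Bruijn indices; quantified variables get index \<open>0\<close>.
\<close>

datatype fm = Mem nat nat | Eq nat nat | Neg fm | Conj fm fm | All fm

primrec sat :: "('v \<Rightarrow> 'v \<Rightarrow> bool) \<Rightarrow> (nat \<Rightarrow> 'v) \<Rightarrow> fm \<Rightarrow> bool" where
  "sat E env (Mem i j) = E (env i) (env j)"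
| "sat E env (Eq i j) = (env i = env j)"
| "sat E env (Neg p) = (\<not> sat E env p)"
| "sat E env (Conj p q) = (sat E env p \<and> sat E env q)"
| "sat E env (All p) = (\<forall>x. sat E (case_nat x env) p)"

section \<open>Models of ZF\<close>

class zf =
  fixes mem :: "'a \<Rightarrow> 'a \<Rightarrow> bool"  (infix "\<^bold>\<in>" 50)
  assumes extensionality: "(\<forall>z. z \<^bold>\<in> x \<longleftrightarrow> z \<^bold>\<in> y) \<Longrightarrow> x = y"
    and foundation: "(\<exists>y. y \<^bold>\<in> x) \<Longrightarrow> \<exists>y. y \<^bold>\<in> x \<and> \<not> (\<exists>z. z \<^bold>\<in> x \<and> z \<^bold>\<in> y)"
    and pairing: "\<exists>z. \<forall>w. w \<^bold>\<in> z \<longleftrightarrow> w = x \<or> w = y"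
    and union: "\<exists>u. \<forall>w. w \<^bold>\<in> u \<longleftrightarrow> (\<exists>y. y \<^bold>\<in> x \<and> w \<^bold>\<in> y)"
    and powerset: "\<exists>p. \<forall>w. w \<^bold>\<in> p \<longleftrightarrow> (\<forall>z. z \<^bold>\<in> w \<longrightarrow> z \<^bold>\<in> x)"
    and infinity: "\<exists>x. (\<exists>e. e \<^bold>\<in> x \<and> (\<forall>z. \<not> z \<^bold>\<in> e)) \<and>
                   (\<forall>y. y \<^bold>\<in> x \<longrightarrow> (\<exists>s. s \<^bold>\<in> x \<and> (\<forall>z. z \<^bold>\<in> s \<longleftrightarrow> z \<^bold>\<in> y \<or> z = y)))"
    and separation: "\<exists>b. \<forall>x. x \<^bold>\<in> b \<longleftrightarrow> x \<^bold>\<in> a \<and> sat mem (case_nat x env) \<phi>"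
    and replacement:
      "(\<forall>x y y'. x \<^bold>\<in> a \<and> sat mem (case_nat x (case_nat y env)) \<phi> \<and>
                 sat mem (case_nat x (case_nat y' env)) \<phi> \<longrightarrow> y = y') \<Longrightarrow>
       \<exists>b. \<forall>y. y \<^bold>\<in> b \<longleftrightarrow> (\<exists>x. x \<^bold>\<in> a \<and> sat mem (case_nat x (case_nat y env)) \<phi>)"

section \<open>Set-theoretic vocabulary inside a model\<close>

definition elts :: "'v::zf \<Rightarrow> 'v set" where
  "elts x = {z. z \<^bold>\<in> x}"

text \<open>
  All quantifiers below range over elements of the universe, so that every defined predicate
  amounts to a first-order formula evaluated in the model.
  \<open>vset S\<close> is the element of the model whose extension is \<open>S\<close>. It is only meaningful for
  extensions \<open>S\<close> that are sets of the model; the lemmas \<open>elts_*\<close> below establish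
  this for every use of it.
\<close>

definition vset :: "'v::zf set \<Rightarrow> 'v" where
  "vset S = (THE x. elts x = S)"

definition opair :: "'v::zf \<Rightarrow> 'v \<Rightarrow> 'v" where
  "opair a b = vset {vset {a}, vset {a, b}}"

definition cprod :: "'v::zf \<Rightarrow> 'v \<Rightarrow> 'v" where
  "cprod A B = vset {opair a b |a b. a \<in> elts A \<and> b \<in> elts B}"

definition sdiff :: "'v::zf \<Rightarrow> 'v \<Rightarrow> 'v" where
  "sdiff A B = vset (elts A - elts B)"

definition vzero :: "'v::zf" where
  "vzero = vset {}"

definition vsucc :: "'v::zf \<Rightarrow> 'v" where
  "vsucc n = vset (insert n (elts n))"

definition is_inductive :: "'v::zf \<Rightarrow> bool" where
  "is_inductive I \<longleftrightarrow> vzero \<in> elts I \<and> (\<forall>n\<in>elts I. vsucc n \<in> elts I)"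

definition omega :: "'v::zf" where
  "omega = vset {n. \<forall>I. is_inductive I \<longrightarrow> n \<in> elts I}"

definition is_fun :: "'v::zf \<Rightarrow> 'v \<Rightarrow> 'v \<Rightarrow> bool" where
  "is_fun f A B \<longleftrightarrow> (\<forall>z\<in>elts f. \<exists>a\<in>elts A. \<exists>b\<in>elts B. z = opair a b) \<and>
                    (\<forall>a\<in>elts A. \<exists>!b. opair a b \<in> elts f)"

definition fspace :: "'v::zf \<Rightarrow> 'v \<Rightarrow> 'v" where
  "fspace A B = vset {f. is_fun f A B}"

definition app :: "'v::zf \<Rightarrow> 'v \<Rightarrow> 'v"  (infixl "\<^bold>\<cdot>" 90) where
  "f \<^bold>\<cdot> x = (THE y. opair x y \<in> elts f)"

text \<open>\<open>upd \<phi> d v\<close> is \<open>\<phi>[d|v]\<close>.\<close>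

definition upd :: "'v::zf \<Rightarrow> 'v \<Rightarrow> 'v \<Rightarrow> 'v" where
  "upd f d v = vset ({z \<in> elts f. \<not> (\<exists>y. z = opair d y)} \<union> {opair d v})"

section \<open>The terms above denote what they should\<close>

text \<open>\<open>dfb P\<close>: the predicate \<open>P\<close> on environments is first-order definable in the model.\<close>

definition dfb :: "((nat \<Rightarrow> 'v::zf) \<Rightarrow> bool) \<Rightarrow> bool" where
  "dfb P \<longleftrightarrow> (\<exists>\<phi>. \<forall>env. P env \<longleftrightarrow> sat mem env \<phi>)"

lemma dfb_mem: "dfb (\<lambda>e. e i \<in> elts (e j))"
  unfolding dfb_def elts_def by (rule exI[of _ "Mem i j"]) simp
lemma dfb_eq: "dfb (\<lambda>e. e i = e j)"
  unfolding dfb_def by (rule exI[of _ "Eq i j"]) simp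
lemma dfb_not: assumes "dfb P" shows "dfb (\<lambda>e. \<not> P e)"
proof -
  obtain \<phi> where "\<And>e. P e \<longleftrightarrow> sat mem e \<phi>" using assms unfolding dfb_def by blast
  then show ?thesis unfolding dfb_def by (intro exI[of _ "Neg \<phi>"]) simp
qed

lemma dfb_conj: assumes "dfb P" "dfb Q" shows "dfb (\<lambda>e. P e \<and> Q e)"
proof -
  obtain \<phi> \<psi> where "\<And>e. P e \<longleftrightarrow> sat mem e \<phi>" "\<And>e. Q e \<longleftrightarrow> sat mem e \<psi>"
    using assms unfolding dfb_def by blast
  then show ?thesis unfolding dfb_def by (intro exI[of _ "Conj \<phi> \<psi>"]) simp
qed

lemma dfb_disj: assumes "dfb P" "dfb Q" shows "dfb (\<lambda>e. P e \<or> Q e)"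
proof -
  have "dfb (\<lambda>e. \<not> (\<not> P e \<and> \<not> Q e))"
    by (rule dfb_not, rule dfb_conj) (rule dfb_not, rule assms)+
  then show ?thesis by simp
qed

lemma dfb_imp: assumes "dfb P" "dfb Q" shows "dfb (\<lambda>e. P e \<longrightarrow> Q e)"
proof -
  have "dfb (\<lambda>e. \<not> P e \<or> Q e)"
    by (rule dfb_disj, rule dfb_not) (rule assms)+
  then show ?thesis by (simp only: imp_conv_disj)
qed

lemma dfb_iff: assumes "dfb P" "dfb Q" shows "dfb (\<lambda>e. P e \<longleftrightarrow> Q e)"
proof -
  have "dfb (\<lambda>e. (P e \<longrightarrow> Q e) \<and> (Q e \<longrightarrow> P e))"
    by (rule dfb_conj) (rule dfb_imp, rule assms, rule assms)+
  then show ?thesis by (simp only: iff_conv_conj_imp)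
qed

lemma dfb_all: assumes "dfb (\<lambda>e. R (e 0) (\<lambda>n. e (Suc n)))" shows "dfb (\<lambda>e. \<forall>x. R x e)"
proof -
  obtain \<phi> where p: "\<And>e. R (e 0) (\<lambda>n. e (Suc n)) \<longleftrightarrow> sat mem e \<phi>"
    using assms unfolding dfb_def by blast
  have "R x e \<longleftrightarrow> sat mem (case_nat x e) \<phi>" for x e
    using p[of "case_nat x e"] by simp
  then show ?thesis unfolding dfb_def by (intro exI[of _ "All \<phi>"]) simp
qed

lemma dfb_ex: assumes "dfb (\<lambda>e. R (e 0) (\<lambda>n. e (Suc n)))" shows "dfb (\<lambda>e. \<exists>x. R x e)"
proof -
  have "dfb (\<lambda>e. \<forall>x. \<not> R x e)"
    by (rule dfb_all, rule dfb_not, rule assms)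
  from dfb_not[OF this] show ?thesis by simp
qed

lemma dfb_ball: assumes "dfb (\<lambda>e. R (e 0) (\<lambda>n. e (Suc n)))" shows "dfb (\<lambda>e. \<forall>x\<in>elts (e i). R x e)"
  unfolding Ball_def by (rule dfb_all, rule dfb_imp, rule dfb_mem, rule assms)
lemma dfb_bex: assumes "dfb (\<lambda>e. R (e 0) (\<lambda>n. e (Suc n)))" shows "dfb (\<lambda>e. \<exists>x\<in>elts (e i). R x e)"
  unfolding Bex_def by (rule dfb_ex, rule dfb_conj, rule dfb_mem, rule assms)
lemmas dfb_intros = dfb_mem dfb_eq dfb_not dfb_conj dfb_disj dfb_imp dfb_iff dfb_ball dfb_bex dfb_all dfb_ex

lemma elts_inject: "elts x = elts y \<longleftrightarrow> x = y"
  using extensionality[of x y] by (auto simp: elts_def set_eq_iff)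

lemma elts_vset: "elts x = S \<Longrightarrow> elts (vset S) = S"
  unfolding vset_def by (rule theI2[of _ x]) (auto simp: elts_inject)

lemma elts_vset_sep:
  assumes "dfb (\<lambda>e. P (e 0) (\<lambda>n. e (Suc n)))" and "\<And>x. P x env \<Longrightarrow> x \<in> elts a"
  shows "elts (vset {x. P x env}) = {x. P x env}"
proof -
  obtain \<phi> where p: "\<And>e. P (e 0) (\<lambda>n. e (Suc n)) \<longleftrightarrow> sat mem e \<phi>" using assms(1) unfolding dfb_def by blast
  obtain b where "\<forall>x. x \<^bold>\<in> b \<longleftrightarrow> x \<^bold>\<in> a \<and> sat mem (case_nat x env) \<phi>" using separation by blast
  then have "elts b = {x. P x env}"
    using p[of "case_nat _ env"] assms(2) by (auto simp: elts_def)
  then show ?thesis by (rule elts_vset)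
qed

lemma sep1: "dfb (\<lambda>e. P (e 0)) \<Longrightarrow> (\<And>x. P x \<Longrightarrow> x \<in> elts a) \<Longrightarrow> elts (vset {x. P x}) = {x. P x}"
  using elts_vset_sep[of "\<lambda>x e. P x" undefined a] by simp
lemma sep2: "dfb (\<lambda>e. P (e 0) (e 1)) \<Longrightarrow> (\<And>x. P x p \<Longrightarrow> x \<in> elts a) \<Longrightarrow> elts (vset {x. P x p}) = {x. P x p}"
  using elts_vset_sep[of "\<lambda>x e. P x (e 0)" "\<lambda>_. p" a] by simp
lemma sep3: "dfb (\<lambda>e. P (e 0) (e 1) (e 2)) \<Longrightarrow> (\<And>x. P x p q \<Longrightarrow> x \<in> elts a)
   \<Longrightarrow> elts (vset {x. P x p q}) = {x. P x p q}"
  using elts_vset_sep[of "\<lambda>x e. P x (e 0) (e 1)" "\<lambda>i. if i = 0 then p else q" a] by (simp add: numeral_2_eq_2)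
lemma sep4: "dfb (\<lambda>e. P (e 0) (e 1) (e 2) (e 3)) \<Longrightarrow> (\<And>x. P x p q r \<Longrightarrow> x \<in> elts a)
   \<Longrightarrow> elts (vset {x. P x p q r}) = {x. P x p q r}"
  using elts_vset_sep[of "\<lambda>x e. P x (e 0) (e 1) (e 2)" "\<lambda>i. if i = 0 then p else if i = 1 then q else r" a]
  by (simp add: numeral_2_eq_2 numeral_3_eq_3)

lemma elts_vset_pair [simp]: "elts (vset {a, b}) = {a, b}"
proof -
  obtain z where "\<forall>w. w \<^bold>\<in> z \<longleftrightarrow> w = a \<or> w = b" using pairing by blast
  then have "elts z = {a, b}" by (auto simp: elts_def)
  then show ?thesis by (rule elts_vset)
qed
lemma elts_vset_single [simp]: "elts (vset {a}) = {a}"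
  using elts_vset_pair[of a a] by simp

lemma vset_inject: "elts x = S \<Longrightarrow> (y = vset S \<longleftrightarrow> elts y = S)"
  using elts_vset elts_inject by metis

lemma opair_inject [simp]: "opair a b = opair c d \<longleftrightarrow> a = c \<and> b = d"
proof
  assume "opair a b = opair c d"
  then have "{vset {a}, vset {a,b}} = {vset {c}, vset{c,d}}" unfolding opair_def by (metis elts_vset_pair)
  then have "elts ` {vset {a}, vset {a,b}} = elts ` {vset {c}, vset{c,d}}" by simp
  then have "{{a},{a,b}} = {{c},{c,d}}" by simp
  then show "a = c \<and> b = d" by (auto simp: doubleton_eq_iff)
qed simp

lemma Un_ex: "\<exists>u. elts u = elts a \<union> elts b"
proof -
  obtain u where "\<forall>w. w \<^bold>\<in> u \<longleftrightarrow> (\<exists>y. y \<^bold>\<in> vset {a,b} \<and> w \<^bold>\<in> y)" using union by blast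
  then have "elts u = elts a \<union> elts b" using elts_vset_pair[of a b] by (auto simp: elts_def)
  then show ?thesis ..
qed
lemma Pow_ex: "\<exists>p. elts p = {w. elts w \<subseteq> elts x}"
  using powerset[of x] by (auto simp: elts_def subset_eq)

lemma elts_vsucc: "elts (vsucc n) = insert n (elts n)"
  unfolding vsucc_def using Un_ex[of "vset {n}" n] by (metis elts_vset elts_vset_single insert_is_Un)

lemma elts_sdiff: "elts (sdiff A B) = elts A - elts B"
  unfolding sdiff_def using sep3[of "\<lambda>x A B. x \<in> elts A \<and> \<not> x \<in> elts B" A B A]
  by (simp add: set_diff_eq dfb_intros)

lemma elts_vzero: "elts vzero = {}"
  unfolding vzero_def using elts_sdiff elts_vset by (metis Diff_cancel)

lemma eq_pair_iff: "z = vset {a, b} \<longleftrightarrow> (\<forall>w. w \<in> elts z \<longleftrightarrow> w = a \<or> w = b)"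
  by (subst vset_inject[OF elts_vset_pair]) auto
lemma dfb_pair: "dfb (\<lambda>e. e i = vset {e j, e k})"
  unfolding eq_pair_iff by (intro dfb_intros)
lemma dfb_single: "dfb (\<lambda>e. e i = vset {e j})"
  using dfb_pair[of i j j] by simp
lemma eq_opair_iff: "z = opair a b \<longleftrightarrow> (\<exists>u v. u = vset {a} \<and> v = vset {a,b} \<and> z = vset {u, v})"
  unfolding opair_def by auto
lemma dfb_opair: "dfb (\<lambda>e. e i = opair (e j) (e k))"
  unfolding eq_opair_iff by (intro dfb_intros dfb_single dfb_pair)
lemma dfb_opair_mem: "dfb (\<lambda>e. opair (e j) (e k) \<in> elts (e i))"
proof -
  have "dfb (\<lambda>e. \<exists>z. z = opair (e j) (e k) \<and> z \<in> elts (e i))"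
    by (intro dfb_intros dfb_opair)
  then show ?thesis by simp
qed

lemma elts_cprod: "elts (cprod A B) = {opair a b |a b. a \<in> elts A \<and> b \<in> elts B}"
proof -
  obtain u where u: "elts u = elts A \<union> elts B" using Un_ex by blast
  obtain p where p: "elts p = {w. elts w \<subseteq> elts u}" using Pow_ex by blast
  obtain q where q: "elts q = {w. elts w \<subseteq> elts p}" using Pow_ex by blast
  have e: "{opair a b |a b. a \<in> elts A \<and> b \<in> elts B} = {z. \<exists>a\<in>elts A. \<exists>b\<in>elts B. z = opair a b}" by blast
  show ?thesis unfolding cprod_def e
  proof (rule sep3[of "\<lambda>z A B. \<exists>a\<in>elts A. \<exists>b\<in>elts B. z = opair a b" A B q])
    show "dfb (\<lambda>e. \<exists>a\<in>elts (e 1). \<exists>b\<in>elts (e 2). e 0 = opair a b)" by (intro dfb_intros dfb_opair)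
    show "\<And>x. \<exists>a\<in>elts A. \<exists>b\<in>elts B. x = opair a b \<Longrightarrow> x \<in> elts q"
      by (auto simp: q p u opair_def)
  qed
qed

lemma dfb_is_fun: "dfb (\<lambda>e. is_fun (e i) (e j) (e k))"
  unfolding is_fun_def Ex1_def by (intro dfb_intros dfb_opair dfb_opair_mem)

lemma elts_fspace: "elts (fspace A B) = {f. is_fun f A B}"
proof -
  obtain p where p: "elts p = {w. elts w \<subseteq> elts (cprod A B)}" using Pow_ex by blast
  show ?thesis unfolding fspace_def
    by (rule sep3[of is_fun A B p]) (rule dfb_is_fun, auto simp: p elts_cprod is_fun_def)
qed

lemma elts_upd: "elts (upd f d v) = {z \<in> elts f. \<not> (\<exists>y. z = opair d y)} \<union> {opair d v}"
proof -
  obtain u where u: "elts u = elts f \<union> elts (vset {opair d v})" using Un_ex by blast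
  have e: "{z \<in> elts f. \<not> (\<exists>y. z = opair d y)} \<union> {opair d v} =
    {z. (z \<in> elts f \<and> \<not> (\<exists>y. z = opair d y)) \<or> z = opair d v}" by blast
  show ?thesis unfolding upd_def e
    by (rule sep4[of "\<lambda>z f d v. (z \<in> elts f \<and> \<not> (\<exists>y. z = opair d y)) \<or> z = opair d v" f d v u])
      (intro dfb_intros dfb_opair, auto simp: u)
qed

lemma eq_vsucc_iff: "z = vsucc n \<longleftrightarrow> (\<forall>w. w \<in> elts z \<longleftrightarrow> w = n \<or> w \<in> elts n)"
  unfolding elts_inject[of z "vsucc n", symmetric] elts_vsucc by auto
lemma dfb_inductive: "dfb (\<lambda>e. is_inductive (e i))"
proof -
  have e: "is_inductive I \<longleftrightarrow> (\<exists>z. (\<forall>w. \<not> w \<in> elts z) \<and> z \<in> elts I) \<and> (\<forall>n\<in>elts I. \<exists>m\<in>elts I. 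
      \<forall>w. w \<in> elts m \<longleftrightarrow> w = n \<or> w \<in> elts n)" for I :: 'a
  proof -
    have z: "(\<forall>w. \<not> w \<in> elts z) \<longleftrightarrow> z = vzero" for z :: 'a
      using elts_inject[of z vzero] elts_vzero by auto
    show ?thesis
    unfolding is_inductive_def eq_vsucc_iff[symmetric] z by blast
  qed
  show ?thesis unfolding e by (intro dfb_intros)
qed

lemma inductive_ex: "\<exists>I. is_inductive (I::'v::zf)"
proof -
  obtain x e :: 'v where "e \<in> elts x" "\<forall>z. z \<notin> elts e"
    and s: "\<forall>y. y \<in> elts x \<longrightarrow> (\<exists>s. s \<in> elts x \<and> (\<forall>z. z \<in> elts s \<longleftrightarrow> z \<in> elts y \<or> z = y))"
    using infinity by (auto simp: elts_def)
  then have "e = vzero" using elts_inject[of e vzero] elts_vzero by auto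
  moreover have "\<forall>y\<in>elts x. vsucc y \<in> elts x"
    using s eq_vsucc_iff by metis
  ultimately show ?thesis using \<open>e \<in> elts x\<close> unfolding is_inductive_def by blast
qed

lemma elts_omega: "elts omega = {n. \<forall>I. is_inductive I \<longrightarrow> n \<in> elts I}"
proof -
  obtain I :: 'a where "is_inductive I" using inductive_ex by blast
  then show ?thesis unfolding omega_def
    by (intro sep1[of "\<lambda>n. \<forall>I. is_inductive I \<longrightarrow> n \<in> elts I" I])
      (intro dfb_intros dfb_inductive, auto)
qed

lemma app_in:
  assumes f: "is_fun f A B" and x: "x \<in> elts A"
  shows "f \<^bold>\<cdot> x \<in> elts B" and "opair x (f \<^bold>\<cdot> x) \<in> elts f"
proof -
  have "\<exists>!y. opair x y \<in> elts f" using f x unfolding is_fun_def by blast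
  then show *: "opair x (f \<^bold>\<cdot> x) \<in> elts f" unfolding app_def by (rule theI')
  have "\<exists>a\<in>elts A. \<exists>b\<in>elts B. opair x (f \<^bold>\<cdot> x) = opair a b"
    using f * unfolding is_fun_def by (elim conjE) (rule bspec)
  then show "f \<^bold>\<cdot> x \<in> elts B" by auto
qed

section \<open>Dependent choice\<close>

class zf_dc = zf +
  assumes dependent_choice:
    "elts A \<noteq> {} \<Longrightarrow> (\<forall>x\<in>elts A. \<exists>y\<in>elts A. opair x y \<in> elts R) \<Longrightarrow>
     \<exists>f\<in>elts (fspace omega A). \<forall>n\<in>elts omega. opair (f \<^bold>\<cdot> n) (f \<^bold>\<cdot> vsucc n) \<in> elts R"

section \<open>Commutative groups inside a model\<close>

definition gadd :: "'v::zf \<Rightarrow> 'v \<Rightarrow> 'v \<Rightarrow> 'v" where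
  "gadd P a b = P \<^bold>\<cdot> opair a b"

definition is_comm_group :: "'v::zf \<Rightarrow> 'v \<Rightarrow> bool" where
  "is_comm_group K P \<longleftrightarrow> P \<in> elts (fspace (cprod K K) K) \<and>
     (\<exists>e. comm_group \<lparr>carrier = elts K, mult = gadd P, one = e\<rparr>)"

definition gminus :: "'v::zf \<Rightarrow> 'v \<Rightarrow> 'v \<Rightarrow> 'v \<Rightarrow> 'v" where
  "gminus K P a b = (THE c. c \<in> elts K \<and> gadd P c b = a)"

lemma gminus_eq: assumes "is_comm_group K P" "a \<in> elts K" "b \<in> elts K"
  shows "gminus K P a b \<in> elts K \<and> gadd P (gminus K P a b) b = a"
proof -
  obtain e where "comm_group \<lparr>carrier = elts K, mult = gadd P, one = e\<rparr>" (is "comm_group ?G")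
    using assms unfolding is_comm_group_def by blast
  then interpret comm_group ?G .
  have "\<exists>!c. c \<in> elts K \<and> gadd P c b = a"
  proof
    show "a \<otimes>\<^bsub>?G\<^esub> inv\<^bsub>?G\<^esub> b \<in> elts K \<and> gadd P (a \<otimes>\<^bsub>?G\<^esub> inv\<^bsub>?G\<^esub> b) b = a"
      using assms m_closed[of a "inv\<^bsub>?G\<^esub> b"] inv_closed[of b] m_assoc[of a "inv\<^bsub>?G\<^esub> b" b] l_inv[of b] r_one[of a] by simp
  next
    fix c assume "c \<in> elts K \<and> gadd P c b = a"
    then show "c = a \<otimes>\<^bsub>?G\<^esub> inv\<^bsub>?G\<^esub> b" using assms inv_solve_right[of c a b] by simp
  qed
  then show ?thesis unfolding gminus_def by (rule theI')
qed

section \<open>Predictors\<close>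

abbreviation colorings :: "'v::zf \<Rightarrow> 'v" where
  "colorings K \<equiv> fspace omega K"

definition agree_off :: "'v::zf \<Rightarrow> 'v \<Rightarrow> 'v \<Rightarrow> bool" where
  "agree_off a f g \<longleftrightarrow> (\<forall>n\<in>elts omega. n \<noteq> a \<longrightarrow> f \<^bold>\<cdot> n = g \<^bold>\<cdot> n)"

text \<open>A family of functions is itself a function of the model, on the index set.\<close>

definition biased_predictor :: "'v::zf \<Rightarrow> 'v \<Rightarrow> 'v \<Rightarrow> bool" where
  "biased_predictor K P G \<longleftrightarrow>
     G \<in> elts (fspace omega (fspace (colorings K) K)) \<and>
     (\<forall>n\<in>elts omega. \<forall>f\<in>elts (colorings K). \<forall>g\<in>elts (colorings K).
        agree_off n f g \<longrightarrow> G \<^bold>\<cdot> n \<^bold>\<cdot> f = G \<^bold>\<cdot> n \<^bold>\<cdot> g) \<and>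
     (\<forall>f\<in>elts (colorings K). \<exists>k\<in>elts K. \<forall>n\<in>elts omega. G \<^bold>\<cdot> n \<^bold>\<cdot> f = gadd P (f \<^bold>\<cdot> n) k)"

text \<open>\<open>H\<close> is the declaration \<open>G\<^sub>s\<close> of the signaler, \<open>G\<close> the family of the other \<open>G\<^sub>n\<close>.\<close>

definition signal_biased_predictor :: "'v::zf \<Rightarrow> 'v \<Rightarrow> 'v \<Rightarrow> 'v \<Rightarrow> 'v \<Rightarrow> bool" where
  "signal_biased_predictor K P s H G \<longleftrightarrow>
     s \<in> elts omega \<and>
     H \<in> elts (fspace (colorings K) K) \<and>
     (\<forall>f\<in>elts (colorings K). \<forall>g\<in>elts (colorings K). agree_off s f g \<longrightarrow> H \<^bold>\<cdot> f = H \<^bold>\<cdot> g) \<and>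
     G \<in> elts (fspace (sdiff omega (vset {s})) (fspace (cprod (colorings K) K) K)) \<and>
     (\<forall>n\<in>elts omega - {s}. \<forall>f\<in>elts (colorings K). \<forall>g\<in>elts (colorings K). \<forall>k\<in>elts K.
        agree_off n f g \<longrightarrow> G \<^bold>\<cdot> n \<^bold>\<cdot> opair f k = G \<^bold>\<cdot> n \<^bold>\<cdot> opair g k) \<and>
     (\<forall>f\<in>elts (colorings K).
        (\<forall>n\<in>elts omega - {s}. G \<^bold>\<cdot> n \<^bold>\<cdot> opair f (H \<^bold>\<cdot> f) = f \<^bold>\<cdot> n) \<and>
        (\<forall>k\<in>elts K. \<forall>l\<in>elts K. \<forall>n\<in>elts omega - {s}.
           gminus K P (G \<^bold>\<cdot> n \<^bold>\<cdot> opair f k) (G \<^bold>\<cdot> n \<^bold>\<cdot> opair f l) = gminus K P l k))"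

definition starter_biased_predictor :: "'v::zf \<Rightarrow> 'v \<Rightarrow> 'v \<Rightarrow> bool" where
  "starter_biased_predictor K P G \<longleftrightarrow>
     G \<in> elts (fspace omega (fspace (colorings K) K)) \<and>
     (\<forall>n\<in>elts omega. \<forall>f\<in>elts (colorings K). \<forall>g\<in>elts (colorings K).
        agree_off n f g \<longrightarrow> G \<^bold>\<cdot> n \<^bold>\<cdot> f = G \<^bold>\<cdot> n \<^bold>\<cdot> g) \<and>
     (\<forall>f\<in>elts (colorings K).
        (\<forall>n\<in>elts omega - {vzero}. G \<^bold>\<cdot> n \<^bold>\<cdot> upd f vzero (G \<^bold>\<cdot> vzero \<^bold>\<cdot> f) = f \<^bold>\<cdot> n) \<and>
        (\<forall>k\<in>elts K. \<forall>l\<in>elts K. \<forall>n\<in>elts omega - {vzero}.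
           gminus K P (G \<^bold>\<cdot> n \<^bold>\<cdot> upd f vzero k) (G \<^bold>\<cdot> n \<^bold>\<cdot> upd f vzero l) = gminus K P l k))"

definition parity_function :: "'v::zf \<Rightarrow> 'v \<Rightarrow> 'v \<Rightarrow> bool" where
  "parity_function K P p \<longleftrightarrow>
     p \<in> elts (fspace (colorings K) K) \<and>
     (\<forall>f\<in>elts (colorings K). \<forall>n\<in>elts omega. \<forall>k\<in>elts K. \<forall>l\<in>elts K.
        gminus K P (p \<^bold>\<cdot> upd f n k) (p \<^bold>\<cdot> upd f n l) = gminus K P l k)"

end

theory Submission
  imports Defs
begin

text \<open>
  A function \<open>p\<close> is a parity function iff \<open>p(f) + f(n)\<close> does not depend on \<open>f(n)\<close>. Hence
  \<open>G\<^sub>n(f) = p(f) + f(n)\<close> is both a biased and a starter-biased predictor, and together with the signal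
  \<open>p(f) + f(0)\<close> the functions \<open>p(f) + f(n) + f(0) - k\<close> form a signal-biased predictor. Conversely, if
  \<open>H\<close> is the declaration of the first agent \<open>s\<close> (any agent in the biased case), then
  \<open>p(f) = H(f) - f(s)\<close> is a parity function. All these functions are definable from parameters by
  first-order formulas, so they exist in the model.
\<close>

section \<open>Definable functions are elements of the model\<close>

text \<open>Only free variables are renamed: below \<open>All\<close>, index 0 is the bound variable
  and stays fixed, and every other index \<open>Suc n\<close> becomes
  \<open>Suc (r n)\<close>.\<close>

primrec rename :: "fm \<Rightarrow> (nat \<Rightarrow> nat) \<Rightarrow> fm" where
  "rename (Mem i j) r = Mem (r i) (r j)"
| "rename (Eq i j) r = Eq (r i) (r j)"
| "rename (Neg p) r = Neg (rename p r)"
| "rename (Conj p q) r = Conj (rename p r) (rename q r)"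
| "rename (All p) r = All (rename p (case_nat 0 (\<lambda>n. Suc (r n))))"

lemma sat_rename: "sat E env (rename p r) \<longleftrightarrow> sat E (\<lambda>n. env (r n)) p"
proof (induction p arbitrary: env r)
  case (All p)
  have "(\<lambda>n. case_nat x env (case_nat 0 (\<lambda>n. Suc (r n)) n)) = case_nat x (\<lambda>n. env (r n))" for x
    by (auto split: nat.split)
  then show ?case by (simp add: All.IH)
qed simp_all

text \<open>Quantifiers shift the indices of arguments and parameters; this moves a definability
  hypothesis to the positions at which they end up.\<close>

lemma dfb_rename:
  assumes "dfb P"
  shows "dfb (\<lambda>e. P (\<lambda>n. e (r n)))"
proof -
  obtain \<phi> where "\<And>e. P e \<longleftrightarrow> sat mem e \<phi>" using assms unfolding dfb_def by blast
  then show ?thesis unfolding dfb_def by (intro exI[of _ "rename \<phi> r"]) (simp add: sat_rename)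
qed

section \<open>Functions of the model and their graphs\<close>

text \<open>Definability is proved for membership of pairs in the graph, while calculations use
  application; this equivalence is the passage between the two.\<close>

lemma fun_app_iff:
  assumes f: "is_fun f A B" and x: "x \<in> elts A"
  shows "opair x y \<in> elts f \<longleftrightarrow> y = f \<^bold>\<cdot> x"
proof -
  have "\<exists>!y. opair x y \<in> elts f" using f x unfolding is_fun_def by blast
  then show ?thesis using app_in(2)[OF f x] by blast
qed

lemma is_fun_curried_app: "is_fun F I (fspace A B) \<Longrightarrow> i \<in> elts I \<Longrightarrow> is_fun (F \<^bold>\<cdot> i) A B"
  using app_in(1)[of F I "fspace A B" i] by (simp add: elts_fspace)

lemma fun_ext:
  assumes f: "is_fun f A B" and g: "is_fun g A B" and eq: "\<And>x. x \<in> elts A \<Longrightarrow> f \<^bold>\<cdot> x = g \<^bold>\<cdot> x"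
  shows "f = g"
proof -
  have sub: "elts u \<subseteq> elts v"
    if u: "is_fun u A B" and v: "is_fun v A B" and eq: "\<And>x. x \<in> elts A \<Longrightarrow> u \<^bold>\<cdot> x = v \<^bold>\<cdot> x" for u v
  proof
    fix z assume z: "z \<in> elts u"
    then obtain a b where a: "a \<in> elts A" and zab: "z = opair a b" using u unfolding is_fun_def by blast
    then have "b = v \<^bold>\<cdot> a" using z fun_app_iff[OF u a] eq[OF a] by simp
    then show "z \<in> elts v" using fun_app_iff[OF v a] zab by simp
  qed
  have "elts f = elts g" using sub[OF f g] sub[OF g f] eq by auto
  then show ?thesis by (simp add: elts_inject)
qed

section \<open>Existence of functions with a definable graph\<close>

text \<open>Separation cuts the graph out of \<open>cprod A B\<close>, and \<open>ex1\<close> makes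
  it functional. In \<open>Q\<close>, indices 0 and 1 hold argument and value; the parameters start
  at index 2.\<close>

lemma fun_ex:
  fixes A B :: "'v::zf"
  assumes Q: "dfb (\<lambda>e. Q (e 0) (e 1) (\<lambda>n. e (n + 2)))"
    and ex1: "\<And>x. x \<in> elts A \<Longrightarrow> \<exists>!y. y \<in> elts B \<and> Q x y env"
  obtains F where "is_fun F A B" "\<And>x. x \<in> elts A \<Longrightarrow> Q x (F \<^bold>\<cdot> x) env"
proof -
  let ?S = "{z. \<exists>x\<in>elts A. \<exists>y\<in>elts B. z = opair x y \<and> Q x y env}"
  \<comment> \<open>\<open>A\<close> and \<open>B\<close> are put in front of the parameters,
    because the formula used for Separation mentions them too.\<close>
  let ?R = "\<lambda>z e. \<exists>x\<in>elts (e 0). \<exists>y\<in>elts (e 1). z = opair x y \<and> Q x y (\<lambda>n. e (n + 2))"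
  let ?env = "case_nat A (case_nat B env)"
  \<comment> \<open>Below the two quantifiers of \<open>?R\<close> the indices 0 to 4 hold
    \<open>y\<close>, \<open>x\<close>, \<open>z\<close>, \<open>A\<close>, \<open>B\<close>, and
    the parameters start at 5.\<close>
  have "dfb (\<lambda>e. Q (e 1) (e 0) (\<lambda>n. e (n + 5)))"
    using dfb_rename[OF Q, of "\<lambda>i. if i = 0 then 1 else if i = 1 then 0 else i + 3"] by (simp add: add.commute)
  then have "dfb (\<lambda>e. ?R (e 0) (\<lambda>n. e (Suc n)))"
    by (intro dfb_intros dfb_opair) (simp add: eval_nat_numeral)
  then have "elts (vset {z. ?R z ?env}) = {z. ?R z ?env}"
    by (rule elts_vset_sep[where a = "cprod A B"]) (auto simp: elts_cprod)
  then have S: "elts (vset ?S) = ?S" by simp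
  have mem: "opair x y \<in> elts (vset ?S) \<longleftrightarrow> x \<in> elts A \<and> y \<in> elts B \<and> Q x y env" for x y
    unfolding S by auto
  have F: "is_fun (vset ?S) A B"
    unfolding is_fun_def mem using ex1 by (auto simp: S)
  moreover have "Q x (vset ?S \<^bold>\<cdot> x) env" if "x \<in> elts A" for x
    using app_in(2)[OF F that] mem by blast
  ultimately show thesis by (rule that)
qed

text \<open>\<open>fun_ex\<close> is used twice: for fixed \<open>i\<close> it gives the section
  \<open>g\<close> from \<open>A\<close> to \<open>B\<close>, and then the map sending
  \<open>i\<close> to this \<open>g\<close>. For the second use \<open>g\<close> must be unique,
  which follows from \<open>fun_ext\<close> and uniqueness of the values.\<close>

lemma curried_fun_ex:
  fixes I A B :: "'v::zf"
  assumes Q: "dfb (\<lambda>e. Q (e 0) (e 1) (e 2) (\<lambda>n. e (n + 3)))"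
    and ex1: "\<And>i x. i \<in> elts I \<Longrightarrow> x \<in> elts A \<Longrightarrow> \<exists>!y. y \<in> elts B \<and> Q i x y env"
  obtains F where "is_fun F I (fspace A B)"
    "\<And>i x. i \<in> elts I \<Longrightarrow> x \<in> elts A \<Longrightarrow> Q i x (F \<^bold>\<cdot> i \<^bold>\<cdot> x) env"
proof -
  let ?Q = "\<lambda>i g e. \<forall>x\<in>elts (e 0). \<forall>y. opair x y \<in> elts g \<longrightarrow> Q i x y (\<lambda>n. e (n + 1))"
  let ?env = "case_nat A env"
  have Q_iff: "?Q i g ?env \<longleftrightarrow> (\<forall>x\<in>elts A. Q i x (g \<^bold>\<cdot> x) env)" if "is_fun g A B" for i g
    using fun_app_iff[OF that] by simp
  \<comment> \<open>The indices 0 to 4 hold \<open>y\<close>, \<open>x\<close>, \<open>i\<close>,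
    \<open>g\<close>, \<open>A\<close> below the quantifiers of \<open>?Q\<close>.\<close>
  have "dfb (\<lambda>e. Q (e 2) (e 1) (e 0) (\<lambda>n. e (n + 5)))"
    using dfb_rename[OF Q, of "\<lambda>i. if i = 0 then 2 else if i = 1 then 1 else if i = 2 then 0 else i + 2"]
    by (simp add: add.commute)
  then have dfbQ: "dfb (\<lambda>e. ?Q (e 0) (e 1) (\<lambda>n. e (n + 2)))"
    by (intro dfb_intros dfb_opair_mem) (simp add: eval_nat_numeral)
  have "\<exists>!g. g \<in> elts (fspace A B) \<and> ?Q i g ?env" if i: "i \<in> elts I" for i
  proof -
    \<comment> \<open>For a single section, \<open>i\<close> is demoted from an argument to the
      first parameter.\<close>
    have "dfb (\<lambda>e. Q (e 2) (e 0) (e 1) (\<lambda>n. e (n + 3)))"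
      using dfb_rename[OF Q, of "\<lambda>i. if i = 0 then 2 else if i = 1 then 0 else if i = 2 then 1 else i"]
      by simp
    then have "dfb (\<lambda>e. (\<lambda>x y e. Q (e 0) x y (\<lambda>n. e (n + 1))) (e 0) (e 1) (\<lambda>n. e (n + 2)))"
      by (simp add: eval_nat_numeral)
    then obtain g where g: "is_fun g A B" "\<And>x. x \<in> elts A \<Longrightarrow> Q i x (g \<^bold>\<cdot> x) env"
      using fun_ex[of "\<lambda>x y e. Q (e 0) x y (\<lambda>n. e (n + 1))" A B "case_nat i env"] ex1[OF i] by auto
    show ?thesis
    proof
      show "g \<in> elts (fspace A B) \<and> ?Q i g ?env" using g Q_iff by (simp add: elts_fspace)
    next
      fix h assume h: "h \<in> elts (fspace A B) \<and> ?Q i h ?env"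
      then have "is_fun h A B" by (simp add: elts_fspace)
      moreover have "h \<^bold>\<cdot> x = g \<^bold>\<cdot> x" if x: "x \<in> elts A" for x
        using ex1[OF i x] app_in(1)[OF \<open>is_fun h A B\<close> x] app_in(1)[OF g(1) x]
          g(2)[OF x] h Q_iff[OF \<open>is_fun h A B\<close>] x by blast
      ultimately show "h = g" using fun_ext g(1) by blast
    qed
  qed
  from fun_ex[of ?Q, OF dfbQ this] obtain F where
    F: "is_fun F I (fspace A B)" "\<And>i. i \<in> elts I \<Longrightarrow> ?Q i (F \<^bold>\<cdot> i) ?env" by blast
  have "is_fun (F \<^bold>\<cdot> i) A B" if "i \<in> elts I" for i
    using is_fun_curried_app[OF F(1) that] .
  then have "Q i x (F \<^bold>\<cdot> i \<^bold>\<cdot> x) env" if "i \<in> elts I" "x \<in> elts A" for i x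
    using F(2) Q_iff that by blast
  with F(1) show thesis by (rule that)
qed

section \<open>Modified functions\<close>

lemma opair_mem_upd: "opair x y \<in> elts (upd f d v) \<longleftrightarrow> (if x = d then y = v else opair x y \<in> elts f)"
  by (auto simp: elts_upd)

lemma is_fun_upd:
  assumes f: "is_fun f A B" and "d \<in> elts A" "v \<in> elts B"
  shows "is_fun (upd f d v) A B"
  unfolding is_fun_def
proof (intro conjI ballI)
  fix z assume "z \<in> elts (upd f d v)"
  then have "z \<in> elts f \<or> z = opair d v" by (auto simp: elts_upd)
  then show "\<exists>a\<in>elts A. \<exists>b\<in>elts B. z = opair a b"
    using assms unfolding is_fun_def by blast
next
  fix a assume "a \<in> elts A"
  then show "\<exists>!b. opair a b \<in> elts (upd f d v)"
    using f unfolding opair_mem_upd is_fun_def by (cases "a = d") simp_all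
qed

lemma upd_app:
  assumes "is_fun f A B" "d \<in> elts A" "v \<in> elts B" "x \<in> elts A"
  shows "upd f d v \<^bold>\<cdot> x = (if x = d then v else f \<^bold>\<cdot> x)"
  using fun_app_iff[OF is_fun_upd[OF assms(1-3)] assms(4)] fun_app_iff[OF assms(1,4)] opair_mem_upd
  by (metis (full_types))

lemma vzero_in_omega [simp]: "vzero \<in> elts omega"
  by (simp add: elts_omega is_inductive_def)

section \<open>Commutative groups in a model\<close>

locale model_comm_group =
  fixes K P :: "'v::zf"
  assumes comm_group: "is_comm_group K P"
begin

abbreviation add (infixl "\<oplus>" 65) where "a \<oplus> b \<equiv> gadd P a b"

lemma is_fun_P: "is_fun P (cprod K K) K"
  using comm_group by (simp add: is_comm_group_def elts_fspace)

lemma add_closed [simp]: "a \<in> elts K \<Longrightarrow> b \<in> elts K \<Longrightarrow> a \<oplus> b \<in> elts K"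
  unfolding gadd_def by (rule app_in(1)[OF is_fun_P]) (auto simp: elts_cprod)

text \<open>Equations in the group become memberships in \<open>P\<close>, to which
  \<open>dfb_opair_mem\<close> applies.\<close>

lemma add_graph:
  assumes "a \<in> elts K" "b \<in> elts K"
  shows "opair (opair a b) c \<in> elts P \<longleftrightarrow> c = a \<oplus> b"
  unfolding gadd_def by (rule fun_app_iff[OF is_fun_P]) (use assms in \<open>auto simp: elts_cprod\<close>)

lemma
  assumes a: "a \<in> elts K" and b: "b \<in> elts K" and c: "c \<in> elts K"
  shows add_assoc: "a \<oplus> b \<oplus> c = a \<oplus> (b \<oplus> c)"
    and add_commute: "a \<oplus> b = b \<oplus> a"
    and add_left_commute: "a \<oplus> (b \<oplus> c) = b \<oplus> (a \<oplus> c)"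
    and add_right_cancel: "a \<oplus> c = b \<oplus> c \<longleftrightarrow> a = b"
proof -
  obtain e where "comm_group \<lparr>carrier = elts K, mult = gadd P, one = e\<rparr>" (is "comm_group ?G")
    using comm_group unfolding is_comm_group_def by blast
  then interpret comm_group ?G .
  show "a \<oplus> b \<oplus> c = a \<oplus> (b \<oplus> c)" "a \<oplus> b = b \<oplus> a" "a \<oplus> (b \<oplus> c) = b \<oplus> (a \<oplus> c)"
    "a \<oplus> c = b \<oplus> c \<longleftrightarrow> a = b"
    using m_assoc[of a b c] m_comm[of a b] m_lcomm[of a b c] right_cancel[of c a b] a b c by simp_all
qed

lemmas add_ac = add_assoc add_commute add_left_commute

lemma subtract_ex1: "a \<in> elts K \<Longrightarrow> b \<in> elts K \<Longrightarrow> \<exists>!c. c \<in> elts K \<and> c \<oplus> b = a"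
  using gminus_eq[OF comm_group] add_right_cancel by metis

lemma gminus_eq_iff:
  assumes K: "a \<in> elts K" "b \<in> elts K" "c \<in> elts K" "d \<in> elts K"
  shows "gminus K P a b = gminus K P c d \<longleftrightarrow> a \<oplus> d = c \<oplus> b"
proof -
  define x y where "x = gminus K P a b" and "y = gminus K P c d"
  have xy: "x \<in> elts K" "x \<oplus> b = a" "y \<in> elts K" "y \<oplus> d = c"
    using gminus_eq[OF comm_group] K unfolding x_def y_def by auto
  \<comment> \<open>Adding \<open>b \<oplus> d\<close> to each of the two differences clears both
    subtractions.\<close>
  have "a \<oplus> d = x \<oplus> (b \<oplus> d)" "c \<oplus> b = y \<oplus> (b \<oplus> d)"
    using xy K by (metis add_assoc, metis add_assoc add_commute)
  then have "a \<oplus> d = c \<oplus> b \<longleftrightarrow> x = y" using xy K by (simp add: add_right_cancel)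
  then show ?thesis unfolding x_def y_def by simp
qed

section \<open>Parity functions\<close>

lemma coloring_app [simp]: "f \<in> elts (colorings K) \<Longrightarrow> n \<in> elts omega \<Longrightarrow> f \<^bold>\<cdot> n \<in> elts K"
  by (rule app_in(1)) (simp add: elts_fspace)

lemma coloring_graph:
  "f \<in> elts (colorings K) \<Longrightarrow> n \<in> elts omega \<Longrightarrow> opair n y \<in> elts f \<longleftrightarrow> y = f \<^bold>\<cdot> n"
  by (rule fun_app_iff) (simp add: elts_fspace)

lemma coloring_upd [simp]:
  "f \<in> elts (colorings K) \<Longrightarrow> n \<in> elts omega \<Longrightarrow> k \<in> elts K \<Longrightarrow> upd f n k \<in> elts (colorings K)"
  by (simp add: elts_fspace is_fun_upd)

lemma coloring_upd_app [simp]: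
  "f \<in> elts (colorings K) \<Longrightarrow> n \<in> elts omega \<Longrightarrow> k \<in> elts K \<Longrightarrow> m \<in> elts omega \<Longrightarrow>
   upd f n k \<^bold>\<cdot> m = (if m = n then k else f \<^bold>\<cdot> m)"
  by (rule upd_app) (simp_all add: elts_fspace)

text \<open>Translates between the two ways of varying a coloring at one agent:
  \<open>agree_off\<close> in the predictors and \<open>upd\<close> in the parity functions.\<close>

lemma upd_eq_of_agree_off:
  assumes "f \<in> elts (colorings K)" "g \<in> elts (colorings K)" "n \<in> elts omega" "agree_off n f g"
  shows "upd f n (g \<^bold>\<cdot> n) = g"
proof (rule fun_ext)
  show "is_fun (upd f n (g \<^bold>\<cdot> n)) omega K" "is_fun g omega K"
    using coloring_upd[OF assms(1,3) coloring_app[OF assms(2,3)]] assms(2) by (simp_all add: elts_fspace)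
qed (use assms in \<open>simp add: agree_off_def\<close>)

text \<open>Clearing the subtractions turns the parity condition into p(f[n|k]) + k = p(f[n|l]) + l,
  and the pairs f[n|k], f[n|l] are exactly the pairs of colorings that agree off n.\<close>

lemma parity_function_iff:
  "parity_function K P p \<longleftrightarrow> is_fun p (colorings K) K \<and>
   (\<forall>n\<in>elts omega. \<forall>f\<in>elts (colorings K). \<forall>g\<in>elts (colorings K).
      agree_off n f g \<longrightarrow> p \<^bold>\<cdot> f \<oplus> f \<^bold>\<cdot> n = p \<^bold>\<cdot> g \<oplus> g \<^bold>\<cdot> n)"
    (is "_ \<longleftrightarrow> _ \<and> ?R")
proof (cases "is_fun p (colorings K) K")
  case True
  then have p: "p \<^bold>\<cdot> f \<in> elts K" if "f \<in> elts (colorings K)" for f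
    using app_in(1) that by metis
  have eq: "gminus K P (p \<^bold>\<cdot> f) (p \<^bold>\<cdot> g) = gminus K P l k \<longleftrightarrow> p \<^bold>\<cdot> f \<oplus> k = p \<^bold>\<cdot> g \<oplus> l"
    if "f \<in> elts (colorings K)" "g \<in> elts (colorings K)" "k \<in> elts K" "l \<in> elts K" for f g k l
    using that p gminus_eq_iff add_commute by metis
  show ?thesis
  proof
    assume par: "parity_function K P p"
    have "p \<^bold>\<cdot> f \<oplus> f \<^bold>\<cdot> n = p \<^bold>\<cdot> g \<oplus> g \<^bold>\<cdot> n"
      if f: "f \<in> elts (colorings K)" and g: "g \<in> elts (colorings K)" and n: "n \<in> elts omega"
        and fg: "agree_off n f g" for n f g
    proof -
      \<comment> \<open>Both colorings are now modifications of \<open>f\<close> at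
        \<open>n\<close>, with the values f(n) and g(n).\<close>
      have "upd f n (f \<^bold>\<cdot> n) = f" by (rule upd_eq_of_agree_off[OF f f n]) (simp add: agree_off_def)
      then have "gminus K P (p \<^bold>\<cdot> f) (p \<^bold>\<cdot> g) = gminus K P (g \<^bold>\<cdot> n) (f \<^bold>\<cdot> n)"
        using par upd_eq_of_agree_off[OF f g n fg] f g n coloring_app unfolding parity_function_def by metis
      then show ?thesis using eq f g n by simp
    qed
    then show "is_fun p (colorings K) K \<and> ?R" using True by blast
  next
    assume R: "is_fun p (colorings K) K \<and> ?R"
    have "gminus K P (p \<^bold>\<cdot> upd f n k) (p \<^bold>\<cdot> upd f n l) = gminus K P l k"
      if "f \<in> elts (colorings K)" "n \<in> elts omega" "k \<in> elts K" "l \<in> elts K" for f n k l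
    proof -
      have "agree_off n (upd f n k) (upd f n l)" using that by (simp add: agree_off_def)
      then have "p \<^bold>\<cdot> upd f n k \<oplus> upd f n k \<^bold>\<cdot> n = p \<^bold>\<cdot> upd f n l \<oplus> upd f n l \<^bold>\<cdot> n"
        using R that coloring_upd by blast
      then show ?thesis using eq that by simp
    qed
    then show "parity_function K P p" using True by (simp add: parity_function_def elts_fspace)
  qed
\<comment> \<open>If \<open>p\<close> is not a function from colorings to \<open>K\<close>, both
  sides are false.\<close>
qed (simp add: parity_function_def elts_fspace)

text \<open>The common core of the three constructions of a parity function: put p(f) = H(f) - f(s).
  For n = s the sum p(f) + f(n) is H(f). For n different from s it is H(f) + f(n) - f(s), where f(s)
  is unchanged by a modification at n.\<close>

lemma parity_function_ex:
  assumes H: "is_fun H (colorings K) K" and s: "s \<in> elts omega"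
    and indep: "\<And>f g. f \<in> elts (colorings K) \<Longrightarrow> g \<in> elts (colorings K) \<Longrightarrow> agree_off s f g \<Longrightarrow>
      H \<^bold>\<cdot> f = H \<^bold>\<cdot> g"
    and other: "\<And>n f g. n \<in> elts omega \<Longrightarrow> n \<noteq> s \<Longrightarrow> f \<in> elts (colorings K) \<Longrightarrow>
      g \<in> elts (colorings K) \<Longrightarrow> agree_off n f g \<Longrightarrow> H \<^bold>\<cdot> f \<oplus> f \<^bold>\<cdot> n = H \<^bold>\<cdot> g \<oplus> g \<^bold>\<cdot> n"
  shows "\<exists>p. parity_function K P p"
proof -
  \<comment> \<open>This spells out y + f(s) = H(f) by graphs: \<open>a\<close> is H(f),
    \<open>b\<close> is f(s), \<open>w\<close> is the pair of summands. The parameters 0, 1, 2 are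
    \<open>H\<close>, \<open>s\<close>, \<open>P\<close>; later positions of \<open>?env\<close> are
    never read.\<close>
  let ?Q = "\<lambda>f y e. \<exists>a b w. opair f a \<in> elts (e 0) \<and> opair (e 1) b \<in> elts f \<and>
    w = opair y b \<and> opair w a \<in> elts (e 2)"
  let ?env = "(!) [H, s, P]"
  have HK: "H \<^bold>\<cdot> f \<in> elts K" if "f \<in> elts (colorings K)" for f
    using app_in(1)[OF H that] .
  have Q: "?Q f y ?env \<longleftrightarrow> y \<oplus> f \<^bold>\<cdot> s = H \<^bold>\<cdot> f" if "f \<in> elts (colorings K)" "y \<in> elts K" for f y
    using that s by (auto simp: fun_app_iff[OF H] coloring_graph add_graph)
  have dfbQ: "dfb (\<lambda>e. ?Q (e 0) (e 1) (\<lambda>n. e (n + 2)))"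
    by (intro dfb_intros dfb_opair dfb_opair_mem)
  have ex1: "\<exists>!y. y \<in> elts K \<and> ?Q f y ?env" if "f \<in> elts (colorings K)" for f
    using subtract_ex1[OF HK[OF that] coloring_app[OF that s]] Q[OF that] by metis
  obtain p where p: "is_fun p (colorings K) K"
    and pQ: "\<And>f. f \<in> elts (colorings K) \<Longrightarrow> ?Q f (p \<^bold>\<cdot> f) ?env"
    using fun_ex[of ?Q, OF dfbQ ex1] by blast
  have pK: "p \<^bold>\<cdot> f \<in> elts K" if "f \<in> elts (colorings K)" for f
    using app_in(1)[OF p that] .
  have pH: "p \<^bold>\<cdot> f \<oplus> f \<^bold>\<cdot> s = H \<^bold>\<cdot> f" if "f \<in> elts (colorings K)" for f
    using Q[OF that pK[OF that]] pQ[OF that] by simp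
  have "p \<^bold>\<cdot> f \<oplus> f \<^bold>\<cdot> n = p \<^bold>\<cdot> g \<oplus> g \<^bold>\<cdot> n"
    if n: "n \<in> elts omega" and f: "f \<in> elts (colorings K)" and g: "g \<in> elts (colorings K)"
      and fg: "agree_off n f g" for n f g
  proof (cases "n = s")
    case True
    then show ?thesis using indep f g fg pH by simp
  next
    case False
    then have s_eq: "f \<^bold>\<cdot> s = g \<^bold>\<cdot> s" using fg s by (simp add: agree_off_def)
    \<comment> \<open>Adding h(s) replaces p by H; since f(s) = g(s), this summand cancels
      afterwards.\<close>
    have "p \<^bold>\<cdot> h \<oplus> h \<^bold>\<cdot> n \<oplus> h \<^bold>\<cdot> s = H \<^bold>\<cdot> h \<oplus> h \<^bold>\<cdot> n" if h: "h \<in> elts (colorings K)" for h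
      using pH[OF h] pK[OF h] h n s coloring_app add_assoc add_commute by metis
    then have "p \<^bold>\<cdot> f \<oplus> f \<^bold>\<cdot> n \<oplus> f \<^bold>\<cdot> s = p \<^bold>\<cdot> g \<oplus> g \<^bold>\<cdot> n \<oplus> f \<^bold>\<cdot> s"
      using other[OF n False f g fg] f g s_eq by metis
    then show ?thesis using pK f g n s by (simp add: add_right_cancel)
  qed
  then show ?thesis using p parity_function_iff by blast
qed

section \<open>The equivalences\<close>

text \<open>Agent 0 serves as signaler. Eliminating the common bias k gives G_0(f) + f(n) = f(0) +
  G_n(f), and for n different from 0 the right side does not depend on f(n).\<close>

lemma parity_from_biased:
  assumes "biased_predictor K P G"
  shows "\<exists>p. parity_function K P p"
proof -
  have G: "is_fun (G \<^bold>\<cdot> n) (colorings K) K" if "n \<in> elts omega" for n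
    using assms that is_fun_curried_app unfolding biased_predictor_def elts_fspace by blast
  have GK: "G \<^bold>\<cdot> n \<^bold>\<cdot> f \<in> elts K" if "n \<in> elts omega" "f \<in> elts (colorings K)" for n f
    using app_in(1)[OF G] that by blast
  have indep: "G \<^bold>\<cdot> n \<^bold>\<cdot> f = G \<^bold>\<cdot> n \<^bold>\<cdot> g"
    if "n \<in> elts omega" "f \<in> elts (colorings K)" "g \<in> elts (colorings K)" "agree_off n f g" for n f g
    using assms that unfolding biased_predictor_def by blast
  have *: "G \<^bold>\<cdot> vzero \<^bold>\<cdot> f \<oplus> f \<^bold>\<cdot> n = f \<^bold>\<cdot> vzero \<oplus> G \<^bold>\<cdot> n \<^bold>\<cdot> f"
    if n: "n \<in> elts omega" and f: "f \<in> elts (colorings K)" for n f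
  proof -
    obtain k where "k \<in> elts K" "\<And>m. m \<in> elts omega \<Longrightarrow> G \<^bold>\<cdot> m \<^bold>\<cdot> f = f \<^bold>\<cdot> m \<oplus> k"
      using assms f unfolding biased_predictor_def by blast
    then show ?thesis using n f vzero_in_omega by (simp add: add_ac)
  qed
  show ?thesis
  proof (rule parity_function_ex[OF G[OF vzero_in_omega] vzero_in_omega])
    fix n f g
    assume "n \<in> elts omega" "n \<noteq> vzero" "f \<in> elts (colorings K)" "g \<in> elts (colorings K)"
      "agree_off n f g"
    moreover from this have "f \<^bold>\<cdot> vzero = g \<^bold>\<cdot> vzero" using vzero_in_omega by (simp add: agree_off_def)
    ultimately show "G \<^bold>\<cdot> vzero \<^bold>\<cdot> f \<oplus> f \<^bold>\<cdot> n = G \<^bold>\<cdot> vzero \<^bold>\<cdot> g \<oplus> g \<^bold>\<cdot> n"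
      using * indep by simp
  qed (use indep vzero_in_omega in blast)
qed

text \<open>Let f and g agree off n. Agent n cannot tell them apart, so on receiving the signal H(g)
  it declares g(n) also at f, while on H(f) it declares f(n). The bias condition compares these two
  declarations at f.\<close>

lemma parity_from_signal_biased:
  assumes "signal_biased_predictor K P s H G"
  shows "\<exists>p. parity_function K P p"
proof (rule parity_function_ex[of H s])
  show H: "is_fun H (colorings K) K" and s: "s \<in> elts omega"
    using assms by (simp_all add: signal_biased_predictor_def elts_fspace)
  show "H \<^bold>\<cdot> f = H \<^bold>\<cdot> g"
    if "f \<in> elts (colorings K)" "g \<in> elts (colorings K)" "agree_off s f g" for f g
    using assms that unfolding signal_biased_predictor_def by blast
  fix n f g
  assume n: "n \<in> elts omega" "n \<noteq> s" and f: "f \<in> elts (colorings K)" and g: "g \<in> elts (colorings K)"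
    and fg: "agree_off n f g"
  have HK: "H \<^bold>\<cdot> f \<in> elts K" "H \<^bold>\<cdot> g \<in> elts K"
    using app_in(1)[OF H] f g by blast+
  have correct: "G \<^bold>\<cdot> n \<^bold>\<cdot> opair h (H \<^bold>\<cdot> h) = h \<^bold>\<cdot> n" if "h \<in> elts (colorings K)" for h
    using assms n that unfolding signal_biased_predictor_def by blast
  have "G \<^bold>\<cdot> n \<^bold>\<cdot> opair f (H \<^bold>\<cdot> g) = G \<^bold>\<cdot> n \<^bold>\<cdot> opair g (H \<^bold>\<cdot> g)"
    using assms n f g fg HK unfolding signal_biased_predictor_def by blast
  moreover have "gminus K P (G \<^bold>\<cdot> n \<^bold>\<cdot> opair f (H \<^bold>\<cdot> f)) (G \<^bold>\<cdot> n \<^bold>\<cdot> opair f (H \<^bold>\<cdot> g)) =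
      gminus K P (H \<^bold>\<cdot> g) (H \<^bold>\<cdot> f)"
    using assms n f HK unfolding signal_biased_predictor_def by blast
  ultimately have "gminus K P (f \<^bold>\<cdot> n) (g \<^bold>\<cdot> n) = gminus K P (H \<^bold>\<cdot> g) (H \<^bold>\<cdot> f)"
    using correct f g by simp
  then show "H \<^bold>\<cdot> f \<oplus> f \<^bold>\<cdot> n = H \<^bold>\<cdot> g \<oplus> g \<^bold>\<cdot> n"
    using gminus_eq_iff add_commute f g n HK coloring_app by metis
qed

text \<open>As for the signal-biased predictor, with the starter's declaration written into position
  0 of the coloring instead of passed as a second argument.\<close>

lemma parity_from_starter_biased:
  assumes "starter_biased_predictor K P G"
  shows "\<exists>p. parity_function K P p"
proof (rule parity_function_ex[OF _ vzero_in_omega])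
  have indep: "G \<^bold>\<cdot> n \<^bold>\<cdot> f = G \<^bold>\<cdot> n \<^bold>\<cdot> g"
    if "n \<in> elts omega" "f \<in> elts (colorings K)" "g \<in> elts (colorings K)" "agree_off n f g" for n f g
    using assms that unfolding starter_biased_predictor_def by blast
  let ?H = "G \<^bold>\<cdot> vzero"
  show H: "is_fun ?H (colorings K) K"
    using assms vzero_in_omega is_fun_curried_app
    unfolding starter_biased_predictor_def elts_fspace by blast
  show "?H \<^bold>\<cdot> f = ?H \<^bold>\<cdot> g"
    if "f \<in> elts (colorings K)" "g \<in> elts (colorings K)" "agree_off vzero f g" for f g
    using indep vzero_in_omega that by blast
  fix n f g
  assume n: "n \<in> elts omega" "n \<noteq> vzero" and f: "f \<in> elts (colorings K)"
    and g: "g \<in> elts (colorings K)" and fg: "agree_off n f g"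
  have HK: "?H \<^bold>\<cdot> f \<in> elts K" "?H \<^bold>\<cdot> g \<in> elts K"
    using app_in(1)[OF H] f g by blast+
  have correct: "G \<^bold>\<cdot> n \<^bold>\<cdot> upd h vzero (?H \<^bold>\<cdot> h) = h \<^bold>\<cdot> n" if "h \<in> elts (colorings K)" for h
    using assms n that unfolding starter_biased_predictor_def by blast
  \<comment> \<open>Both colorings receive the same value at 0, so they still differ at most at
    \<open>n\<close>.\<close>
  have "agree_off n (upd f vzero (?H \<^bold>\<cdot> g)) (upd g vzero (?H \<^bold>\<cdot> g))"
    using fg f g HK vzero_in_omega by (simp add: agree_off_def)
  then have "G \<^bold>\<cdot> n \<^bold>\<cdot> upd f vzero (?H \<^bold>\<cdot> g) = G \<^bold>\<cdot> n \<^bold>\<cdot> upd g vzero (?H \<^bold>\<cdot> g)"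
    using indep n f g HK vzero_in_omega coloring_upd by blast
  moreover have "gminus K P (G \<^bold>\<cdot> n \<^bold>\<cdot> upd f vzero (?H \<^bold>\<cdot> f)) (G \<^bold>\<cdot> n \<^bold>\<cdot> upd f vzero (?H \<^bold>\<cdot> g)) =
      gminus K P (?H \<^bold>\<cdot> g) (?H \<^bold>\<cdot> f)"
    using assms n f HK unfolding starter_biased_predictor_def by blast
  ultimately have "gminus K P (f \<^bold>\<cdot> n) (g \<^bold>\<cdot> n) = gminus K P (?H \<^bold>\<cdot> g) (?H \<^bold>\<cdot> f)"
    using correct f g by simp
  then show "?H \<^bold>\<cdot> f \<oplus> f \<^bold>\<cdot> n = ?H \<^bold>\<cdot> g \<oplus> g \<^bold>\<cdot> n"
    using gminus_eq_iff add_commute f g n HK coloring_app by metis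
qed

section \<open>From parity functions to predictors\<close>

text \<open>The family G_n(f) = p(f) + f(n) underlies all three predictors; its independence of f(n)
  is \<open>parity_function_iff\<close>.\<close>

lemma family_from_parity:
  assumes "parity_function K P p"
  obtains G where "is_fun G omega (fspace (colorings K) K)"
    "\<And>n f. n \<in> elts omega \<Longrightarrow> f \<in> elts (colorings K) \<Longrightarrow> G \<^bold>\<cdot> n \<^bold>\<cdot> f = p \<^bold>\<cdot> f \<oplus> f \<^bold>\<cdot> n"
    "\<And>n f g. n \<in> elts omega \<Longrightarrow> f \<in> elts (colorings K) \<Longrightarrow> g \<in> elts (colorings K) \<Longrightarrow>
       agree_off n f g \<Longrightarrow> G \<^bold>\<cdot> n \<^bold>\<cdot> f = G \<^bold>\<cdot> n \<^bold>\<cdot> g"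
proof -
  have p: "is_fun p (colorings K) K" using assms parity_function_iff by blast
  have pK: "p \<^bold>\<cdot> f \<in> elts K" if "f \<in> elts (colorings K)" for f
    using app_in(1)[OF p that] .
  \<comment> \<open>The graph form of y = p(f) + f(n), with \<open>a\<close> for p(f),
    \<open>b\<close> for f(n), and parameters \<open>p\<close> and \<open>P\<close>.\<close>
  let ?Q = "\<lambda>n f y e. \<exists>a b w. opair f a \<in> elts (e 0) \<and> opair n b \<in> elts f \<and>
    w = opair a b \<and> opair w y \<in> elts (e 1)"
  let ?env = "(!) [p, P]"
  have Q: "?Q n f y ?env \<longleftrightarrow> y = p \<^bold>\<cdot> f \<oplus> f \<^bold>\<cdot> n"
    if "n \<in> elts omega" "f \<in> elts (colorings K)" for n f y
    using that pK by (auto simp: fun_app_iff[OF p] coloring_graph add_graph)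
  have dfbQ: "dfb (\<lambda>e. ?Q (e 0) (e 1) (e 2) (\<lambda>n. e (n + 3)))"
    by (intro dfb_intros dfb_opair dfb_opair_mem)
  have ex1: "\<exists>!y. y \<in> elts K \<and> ?Q n f y ?env"
    if "n \<in> elts omega" "f \<in> elts (colorings K)" for n f
    unfolding Q[OF that] using add_closed[OF pK[OF that(2)] coloring_app[OF that(2,1)]] by blast
  obtain G where G: "is_fun G omega (fspace (colorings K) K)"
    and GQ: "\<And>n f. n \<in> elts omega \<Longrightarrow> f \<in> elts (colorings K) \<Longrightarrow> ?Q n f (G \<^bold>\<cdot> n \<^bold>\<cdot> f) ?env"
    using curried_fun_ex[of ?Q, OF dfbQ ex1] by blast
  have eq: "G \<^bold>\<cdot> n \<^bold>\<cdot> f = p \<^bold>\<cdot> f \<oplus> f \<^bold>\<cdot> n" if "n \<in> elts omega" "f \<in> elts (colorings K)" for n f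
    using GQ[OF that] unfolding Q[OF that] .
  have "G \<^bold>\<cdot> n \<^bold>\<cdot> f = G \<^bold>\<cdot> n \<^bold>\<cdot> g"
    if "n \<in> elts omega" "f \<in> elts (colorings K)" "g \<in> elts (colorings K)" "agree_off n f g" for n f g
    using eq that assms parity_function_iff by simp
  then show thesis using that G eq by blast
qed

text \<open>The common bias at f is p(f) itself.\<close>

lemma biased_from_parity:
  assumes "parity_function K P p"
  shows "\<exists>G. biased_predictor K P G"
proof -
  have p: "p \<^bold>\<cdot> f \<in> elts K" if "f \<in> elts (colorings K)" for f
    using assms app_in(1)[OF _ that] parity_function_iff by blast
  obtain G where G: "is_fun G omega (fspace (colorings K) K)"
    "\<And>n f. n \<in> elts omega \<Longrightarrow> f \<in> elts (colorings K) \<Longrightarrow> G \<^bold>\<cdot> n \<^bold>\<cdot> f = p \<^bold>\<cdot> f \<oplus> f \<^bold>\<cdot> n"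
    "\<And>n f g. n \<in> elts omega \<Longrightarrow> f \<in> elts (colorings K) \<Longrightarrow> g \<in> elts (colorings K) \<Longrightarrow>
       agree_off n f g \<Longrightarrow> G \<^bold>\<cdot> n \<^bold>\<cdot> f = G \<^bold>\<cdot> n \<^bold>\<cdot> g"
    using family_from_parity[OF assms] by blast
  have "G \<^bold>\<cdot> n \<^bold>\<cdot> f = f \<^bold>\<cdot> n \<oplus> p \<^bold>\<cdot> f" if "n \<in> elts omega" "f \<in> elts (colorings K)" for n f
    using G(2)[OF that] add_commute p that coloring_app by metis
  then have "biased_predictor K P G"
    unfolding biased_predictor_def elts_fspace[of omega "fspace (colorings K) K"]
    using G(1,3) p by blast
  then show ?thesis ..
qed

text \<open>Everything follows from the identity \<open>Gk\<close>, G_n(f[0|k]) + k = f(n) + G_0(f):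
  taking k = G_0(f) gives correctness, and comparing two values of k gives the bias
  condition.\<close>

lemma starter_biased_from_parity:
  assumes "parity_function K P p"
  shows "\<exists>G. starter_biased_predictor K P G"
proof -
  have p: "p \<^bold>\<cdot> f \<in> elts K" if "f \<in> elts (colorings K)" for f
    using assms app_in(1)[OF _ that] parity_function_iff by blast
  obtain G where G: "is_fun G omega (fspace (colorings K) K)"
    and Geq: "\<And>n f. n \<in> elts omega \<Longrightarrow> f \<in> elts (colorings K) \<Longrightarrow> G \<^bold>\<cdot> n \<^bold>\<cdot> f = p \<^bold>\<cdot> f \<oplus> f \<^bold>\<cdot> n"
    and indep: "\<And>n f g. n \<in> elts omega \<Longrightarrow> f \<in> elts (colorings K) \<Longrightarrow> g \<in> elts (colorings K) \<Longrightarrow>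
       agree_off n f g \<Longrightarrow> G \<^bold>\<cdot> n \<^bold>\<cdot> f = G \<^bold>\<cdot> n \<^bold>\<cdot> g"
    using family_from_parity[OF assms] by blast
  \<comment> \<open>The left side is G_0(f[0|k]), and G_0 ignores the value at 0.\<close>
  have G0: "p \<^bold>\<cdot> upd f vzero k \<oplus> k = G \<^bold>\<cdot> vzero \<^bold>\<cdot> f"
    if f: "f \<in> elts (colorings K)" and k: "k \<in> elts K" for f k
  proof -
    have "agree_off vzero (upd f vzero k) f" using f k vzero_in_omega by (simp add: agree_off_def)
    then have "G \<^bold>\<cdot> vzero \<^bold>\<cdot> upd f vzero k = G \<^bold>\<cdot> vzero \<^bold>\<cdot> f"
      using indep f k vzero_in_omega by simp
    then show ?thesis using Geq[OF vzero_in_omega] f k vzero_in_omega by simp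
  qed
  have G0K: "G \<^bold>\<cdot> vzero \<^bold>\<cdot> f \<in> elts K" if "f \<in> elts (colorings K)" for f
    using Geq that p vzero_in_omega by simp
  have Gn: "G \<^bold>\<cdot> n \<^bold>\<cdot> upd f vzero k = p \<^bold>\<cdot> upd f vzero k \<oplus> f \<^bold>\<cdot> n"
    if "n \<in> elts omega - {vzero}" "f \<in> elts (colorings K)" "k \<in> elts K" for n f k
    using Geq that vzero_in_omega by simp
  have Gk: "G \<^bold>\<cdot> n \<^bold>\<cdot> upd f vzero k \<oplus> k = f \<^bold>\<cdot> n \<oplus> G \<^bold>\<cdot> vzero \<^bold>\<cdot> f"
    if n: "n \<in> elts omega - {vzero}" and f: "f \<in> elts (colorings K)" and k: "k \<in> elts K" for n f k
  proof -
    have "p \<^bold>\<cdot> upd f vzero k \<oplus> f \<^bold>\<cdot> n \<oplus> k = f \<^bold>\<cdot> n \<oplus> (p \<^bold>\<cdot> upd f vzero k \<oplus> k)"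
      using p n f k vzero_in_omega by (simp add: add_ac)
    then show ?thesis using Gn[OF n f k] G0[OF f k] by simp
  qed
  have GK: "G \<^bold>\<cdot> n \<^bold>\<cdot> upd f vzero k \<in> elts K"
    if "n \<in> elts omega - {vzero}" "f \<in> elts (colorings K)" "k \<in> elts K" for n f k
    using Gn that p vzero_in_omega by simp
  have correct: "G \<^bold>\<cdot> n \<^bold>\<cdot> upd f vzero (G \<^bold>\<cdot> vzero \<^bold>\<cdot> f) = f \<^bold>\<cdot> n"
    if n: "n \<in> elts omega - {vzero}" and f: "f \<in> elts (colorings K)" for n f
    using Gk[OF n f G0K[OF f]] GK[OF n f G0K[OF f]] add_right_cancel G0K[OF f] coloring_app[OF f] n
    by blast
  have "gminus K P (G \<^bold>\<cdot> n \<^bold>\<cdot> upd f vzero k) (G \<^bold>\<cdot> n \<^bold>\<cdot> upd f vzero l) = gminus K P l k"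
    if n: "n \<in> elts omega - {vzero}" and f: "f \<in> elts (colorings K)"
      and k: "k \<in> elts K" and l: "l \<in> elts K" for n f k l
    using Gk[OF n f k] Gk[OF n f l] GK[OF n f k] GK[OF n f l] gminus_eq_iff add_commute k l by metis
  then have "starter_biased_predictor K P G"
    unfolding starter_biased_predictor_def elts_fspace[of omega "fspace (colorings K) K"]
    using G indep correct by blast
  then show ?thesis ..
qed

text \<open>With the common family F, the signal is F_0(f) and G_n(f,k) = F_n(f) + f(0) - k. The
  summand f(0) does not depend on f(n) because n differs from 0.\<close>

lemma signal_biased_from_parity:
  assumes "parity_function K P p"
  shows "\<exists>s H G. signal_biased_predictor K P s H G"
proof -
  have p: "p \<^bold>\<cdot> f \<in> elts K" if "f \<in> elts (colorings K)" for f
    using assms app_in(1)[OF _ that] parity_function_iff by blast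
  obtain F where F: "is_fun F omega (fspace (colorings K) K)"
    and Feq: "\<And>n f. n \<in> elts omega \<Longrightarrow> f \<in> elts (colorings K) \<Longrightarrow> F \<^bold>\<cdot> n \<^bold>\<cdot> f = p \<^bold>\<cdot> f \<oplus> f \<^bold>\<cdot> n"
    and indep: "\<And>n f g. n \<in> elts omega \<Longrightarrow> f \<in> elts (colorings K) \<Longrightarrow> g \<in> elts (colorings K) \<Longrightarrow>
       agree_off n f g \<Longrightarrow> F \<^bold>\<cdot> n \<^bold>\<cdot> f = F \<^bold>\<cdot> n \<^bold>\<cdot> g"
    using family_from_parity[OF assms] by blast
  have Fn: "is_fun (F \<^bold>\<cdot> n) (colorings K) K" if "n \<in> elts omega" for n
    using is_fun_curried_app[OF F that] .
  have FK: "F \<^bold>\<cdot> n \<^bold>\<cdot> f \<in> elts K" if "n \<in> elts omega" "f \<in> elts (colorings K)" for n f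
    using app_in(1)[OF Fn] that by blast
  let ?I = "sdiff omega (vset {vzero})"
  have I: "elts ?I = elts omega - {vzero}" by (simp add: elts_sdiff)
  \<comment> \<open>After decoding \<open>z\<close> as the pair of \<open>f\<close> and
    \<open>k\<close>, this states y + k = F_n(f) + f(0): \<open>h\<close> is F_n, \<open>a\<close>
    is F_n(f), \<open>b\<close> is f(0), and \<open>c\<close> is the common sum.
    \<open>vzero\<close> enters as parameter 1, between \<open>F\<close> and
    \<open>P\<close>.\<close>
  let ?Q = "\<lambda>n z y e. \<exists>f k h a b u c w. z = opair f k \<and> opair n h \<in> elts (e 0) \<and>
    opair f a \<in> elts h \<and> opair (e 1) b \<in> elts f \<and> u = opair a b \<and> opair u c \<in> elts (e 2) \<and>
    w = opair y k \<and> opair w c \<in> elts (e 2)"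
  let ?env = "(!) [F, vzero, P]"
  have Q: "?Q n (opair f k) y ?env \<longleftrightarrow> y \<oplus> k = F \<^bold>\<cdot> n \<^bold>\<cdot> f \<oplus> f \<^bold>\<cdot> vzero"
    if "n \<in> elts omega" "f \<in> elts (colorings K)" "k \<in> elts K" "y \<in> elts K" for n f k y
    using that FK vzero_in_omega
    by (auto simp: fun_app_iff[OF F] fun_app_iff[OF Fn] coloring_graph add_graph)
  have dfbQ: "dfb (\<lambda>e. ?Q (e 0) (e 1) (e 2) (\<lambda>n. e (n + 3)))"
    by (intro dfb_intros dfb_opair dfb_opair_mem)
  have ex1: "\<exists>!y. y \<in> elts K \<and> ?Q n z y ?env"
    if n: "n \<in> elts ?I" and z: "z \<in> elts (cprod (colorings K) K)" for n z
  proof -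
    obtain f k where fk: "z = opair f k" "f \<in> elts (colorings K)" "k \<in> elts K"
      using z by (auto simp: elts_cprod)
    have n': "n \<in> elts omega" using n I by blast
    have "\<exists>!y. y \<in> elts K \<and> y \<oplus> k = F \<^bold>\<cdot> n \<^bold>\<cdot> f \<oplus> f \<^bold>\<cdot> vzero"
      using subtract_ex1 FK n' fk vzero_in_omega by simp
    then show ?thesis unfolding fk(1) using Q[OF n' fk(2,3)] by (smt (verit))
  qed
  obtain G where G: "is_fun G ?I (fspace (cprod (colorings K) K) K)"
    and GQ: "\<And>n z. n \<in> elts ?I \<Longrightarrow> z \<in> elts (cprod (colorings K) K) \<Longrightarrow> ?Q n z (G \<^bold>\<cdot> n \<^bold>\<cdot> z) ?env"
    by (rule curried_fun_ex[of ?Q, OF dfbQ ex1]) (assumption, assumption, rule that, assumption, blast)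
  have GK: "G \<^bold>\<cdot> n \<^bold>\<cdot> opair f k \<in> elts K"
    if "n \<in> elts omega - {vzero}" "f \<in> elts (colorings K)" "k \<in> elts K" for n f k
    by (rule app_in(1)[OF is_fun_curried_app[OF G]]) (use that in \<open>auto simp: I elts_cprod\<close>)
  have Gk: "G \<^bold>\<cdot> n \<^bold>\<cdot> opair f k \<oplus> k = F \<^bold>\<cdot> n \<^bold>\<cdot> f \<oplus> f \<^bold>\<cdot> vzero"
    if n: "n \<in> elts omega - {vzero}" and f: "f \<in> elts (colorings K)" and k: "k \<in> elts K" for n f k
  proof -
    have n': "n \<in> elts ?I" using n I by blast
    have "opair f k \<in> elts (cprod (colorings K) K)" using f k by (auto simp: elts_cprod)
    from GQ[OF n' this] show ?thesis using Q[OF _ f k GK[OF n f k]] n by blast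
  qed
  have indepG: "G \<^bold>\<cdot> n \<^bold>\<cdot> opair f k = G \<^bold>\<cdot> n \<^bold>\<cdot> opair g k"
    if n: "n \<in> elts omega - {vzero}" and f: "f \<in> elts (colorings K)" and g: "g \<in> elts (colorings K)"
      and k: "k \<in> elts K" and fg: "agree_off n f g" for n f g k
  proof -
    have "f \<^bold>\<cdot> vzero = g \<^bold>\<cdot> vzero" using fg n vzero_in_omega by (auto simp: agree_off_def)
    moreover have "F \<^bold>\<cdot> n \<^bold>\<cdot> f = F \<^bold>\<cdot> n \<^bold>\<cdot> g" using indep n f g fg by blast
    ultimately show ?thesis
      using Gk[OF n f k] Gk[OF n g k] GK[OF n f k] GK[OF n g k] add_right_cancel k by metis
  qed
  have correct: "G \<^bold>\<cdot> n \<^bold>\<cdot> opair f (F \<^bold>\<cdot> vzero \<^bold>\<cdot> f) = f \<^bold>\<cdot> n"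
    if n: "n \<in> elts omega - {vzero}" and f: "f \<in> elts (colorings K)" for n f
  proof -
    let ?k = "F \<^bold>\<cdot> vzero \<^bold>\<cdot> f"
    have k: "?k \<in> elts K" using FK vzero_in_omega f by blast
    have fn: "f \<^bold>\<cdot> n \<in> elts K" using n f by simp
    \<comment> \<open>Both sides equal p(f) + f(n) + f(0), so subtracting the signal leaves
      f(n).\<close>
    have "F \<^bold>\<cdot> n \<^bold>\<cdot> f \<oplus> f \<^bold>\<cdot> vzero = f \<^bold>\<cdot> n \<oplus> ?k"
      using Feq n f p vzero_in_omega by (simp add: add_ac)
    then show ?thesis using Gk[OF n f k] GK[OF n f k] add_right_cancel k fn by metis
  qed
  have bias: "gminus K P (G \<^bold>\<cdot> n \<^bold>\<cdot> opair f k) (G \<^bold>\<cdot> n \<^bold>\<cdot> opair f l) = gminus K P l k"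
    if n: "n \<in> elts omega - {vzero}" and f: "f \<in> elts (colorings K)"
      and k: "k \<in> elts K" and l: "l \<in> elts K" for n f k l
    using Gk[OF n f k] Gk[OF n f l] GK[OF n f k] GK[OF n f l] gminus_eq_iff add_commute k l by metis
  have "signal_biased_predictor K P vzero (F \<^bold>\<cdot> vzero) G"
    unfolding signal_biased_predictor_def elts_fspace[of ?I] elts_fspace[of "colorings K"]
    using vzero_in_omega Fn indep G indepG correct bias by blast
  then show ?thesis by blast
qed

end

theorem theorem2p6:
  fixes K P :: "'v::zf_dc"
  assumes "is_comm_group K P"
  shows "((\<exists>G. biased_predictor K P G) \<longleftrightarrow> (\<exists>s H G. signal_biased_predictor K P s H G)) \<and>
         ((\<exists>s H G. signal_biased_predictor K P s H G) \<longleftrightarrow> (\<exists>G. starter_biased_predictor K P G)) \<and>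
         ((\<exists>G. starter_biased_predictor K P G) \<longleftrightarrow> (\<exists>p. parity_function K P p))"
proof -
  interpret model_comm_group K P by standard (rule assms)
  \<comment> \<open>The parity function is the hub: each kind of predictor yields one and is
    obtained from one.\<close>
  show ?thesis
    using parity_from_biased parity_from_signal_biased parity_from_starter_biased
      biased_from_parity signal_biased_from_parity starter_biased_from_parity by blast
qed

end
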